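(* Let $\Omega\subset I\times I$ be a serrated domain and let $K_\star$ be a covariance on $I$. Then $K_\star$ is the canonical completion of its restriction $K_\star|_\Omega$ if and only if $K_\star$ is the canonical completion of a partial covariance on some nearly serrated domain $\widetilde\Omega\subset\Omega$.
   Context: $I\subset\mathbb{R}$ is an interval. A covariance on a set $S$ is a symmetric function $K:S\times S\to\mathbb{R}$ with $\sum_{i,j=1}^n\alpha_i\alpha_jK(t_i,t_j)\ge 0$ for all $n\ge1$, $t_i\in S$, $\alpha_i\in\mathbb{R}$; $\mathscr{C}$ is the set of covariances on $I$. A symmetric domain is a set $\Omega\subset I\times I$ containing the diagonal with $(s,t)\in\Omega$ iff $(t,s)\in\Omega$. A partial covariance on a symmetric domain $\Omega$ is a function $K_\Omega:\Omega\to\mathbb{R}$ such that $K_\Omega|_{J\times J}$ is a covariance on $J$ whenever $J\subset I$ and $J\times J\subset\Omega$. A completion of $K_\Omega$ is a covariance $K$ on $I$ with $K|_\Omega=K_\Omega$. A serrated domain is $\bigcup_{j=1}^m(I_j\times I_j)$ with $\{I_j\}$ a finite collection of subintervals covering $I$. A (symmetric) domain $\widetilde\Omega\subset I\times I$ is nearly serrated if for every $\epsilon>0$ there are serrated domains $\Omega_\epsilon\subset\widetilde\Omega\subset\Omega^\epsilon$ with $d_H(\widetilde\Omega,\Omega_\epsilon)<\epsilon$ and $d_H(\widetilde\Omega,\Omega^\epsilon)<\epsilon$, where $d_H$ is the Hausdorff distance induced by the Euclidean metric on $\mathbb{R}^2$ (every serrated domain is nearly serrated). A set $J\subset I$ separates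 $s,t\in I$ in $\Omega$ if for every finite sequence $t_1=s,t_2,\dots,t_r=t$ in $I$ ($r\ge1$) with $(t_i,t_{i+1})\in\Omega$ for $1\le i<r$, there is $1<j<r$ with $t_j\in J$. Let $$\mathscr{G}_\Omega=\Big\{K\in\mathscr{C}:K(s,t)=\big\langle K(s,\cdot),K(\cdot,t)\big\rangle_{\mathscr{H}(K_J)}\text{ for all }J\subset I\text{ separating }s,t\in I\text{ in }\Omega\Big\},$$ where $K_J=K|_{J\times J}$, $\mathscr{H}(K_J)$ is its reproducing kernel Hilbert space ($\mathscr{H}(K_\emptyset)=\{0\}$), and functions in the inner product are restricted to $J$. A covariance $K$ is a canonical completion of $K_\Omega$ (for $\Omega$ serrated or nearly serrated) if $K|_\Omega=K_\Omega$ and $K\in\mathscr{G}_\Omega$; for serrated $\Omega$ the canonical completion exists and is unique. *)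

theory Defs
  imports "HOL-Analysis.Analysis"
begin

text \<open>
  A kernel on a set \<open>S\<close> is a function \<open>K :: 'a \<times> 'a \<Rightarrow> real\<close> of which only the values on
  \<open>S \<times> S\<close> matter, and likewise for functions on a domain \<open>\<Omega>\<close>.
  The restriction of \<open>K\<close> to \<open>\<Omega>\<close> is \<open>restrict K \<Omega>\<close>.
\<close>

definition covariance_on :: "'a set \<Rightarrow> ('a \<times> 'a \<Rightarrow> real) \<Rightarrow> bool" where
  "covariance_on S K \<longleftrightarrow>
     (\<forall>s\<in>S. \<forall>t\<in>S. K (s, t) = K (t, s)) \<and>
     (\<forall>n\<ge>1. \<forall>(t :: nat \<Rightarrow> 'a) (\<alpha> :: nat \<Rightarrow> real). (\<forall>i\<in>{1..n}. t i \<in> S) \<longrightarrow>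
        0 \<le> (\<Sum>i=1..n. \<Sum>j=1..n. \<alpha> i * \<alpha> j * K (t i, t j)))"

definition symmetric_domain :: "'a set \<Rightarrow> ('a \<times> 'a) set \<Rightarrow> bool" where
  "symmetric_domain I \<Omega> \<longleftrightarrow>
     \<Omega> \<subseteq> I \<times> I \<and> (\<forall>t\<in>I. (t, t) \<in> \<Omega>) \<and> (\<forall>s t. (s, t) \<in> \<Omega> \<longleftrightarrow> (t, s) \<in> \<Omega>)"

definition partial_covariance :: "'a set \<Rightarrow> ('a \<times> 'a) set \<Rightarrow> ('a \<times> 'a \<Rightarrow> real) \<Rightarrow> bool" where
  "partial_covariance I \<Omega> K\<^sub>\<Omega> \<longleftrightarrow>
     symmetric_domain I \<Omega> \<and>
     (\<forall>J. J \<subseteq> I \<and> J \<times> J \<subseteq> \<Omega> \<longrightarrow> covariance_on J (restrict K\<^sub>\<Omega> (J \<times> J)))"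

definition completion ::
  "'a set \<Rightarrow> ('a \<times> 'a) set \<Rightarrow> ('a \<times> 'a \<Rightarrow> real) \<Rightarrow> ('a \<times> 'a \<Rightarrow> real) \<Rightarrow> bool" where
  "completion I \<Omega> K\<^sub>\<Omega> K \<longleftrightarrow> covariance_on I K \<and> (\<forall>p\<in>\<Omega>. K p = K\<^sub>\<Omega> p)"

definition serrated :: "real set \<Rightarrow> (real \<times> real) set \<Rightarrow> bool" where
  "serrated I \<Omega> \<longleftrightarrow>
     (\<exists>\<J>. finite \<J> \<and> (\<forall>J\<in>\<J>. is_interval J \<and> J \<subseteq> I) \<and> \<Union>\<J> = I \<and> \<Omega> = (\<Union>J\<in>\<J>. J \<times> J))"

text \<open>
  The Hausdorff distance takes values in the extended nonnegative reals, because domains over an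
  unbounded interval may be infinitely far apart. On \<open>real \<times> real\<close>, \<open>dist\<close> is Euclidean.
\<close>

definition hausdorff_dist :: "'a::metric_space set \<Rightarrow> 'a set \<Rightarrow> ennreal" where
  "hausdorff_dist A B =
     max (SUP a\<in>A. INF b\<in>B. ennreal (dist a b)) (SUP b\<in>B. INF a\<in>A. ennreal (dist a b))"

definition nearly_serrated :: "real set \<Rightarrow> (real \<times> real) set \<Rightarrow> bool" where
  "nearly_serrated I \<Omega> \<longleftrightarrow>
     symmetric_domain I \<Omega> \<and>
     (\<forall>\<epsilon>>0. \<exists>L U. serrated I L \<and> serrated I U \<and> L \<subseteq> \<Omega> \<and> \<Omega> \<subseteq> U \<and>
        hausdorff_dist \<Omega> L < ennreal \<epsilon> \<and> hausdorff_dist \<Omega> U < ennreal \<epsilon>)"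

definition separates :: "'a set \<Rightarrow> ('a \<times> 'a) set \<Rightarrow> 'a set \<Rightarrow> 'a \<Rightarrow> 'a \<Rightarrow> bool" where
  "separates I \<Omega> J s t \<longleftrightarrow>
     (\<forall>r\<ge>1. \<forall>\<tau> :: nat \<Rightarrow> 'a.
        (\<forall>i\<in>{1..r}. \<tau> i \<in> I) \<and> \<tau> 1 = s \<and> \<tau> r = t \<and>
        (\<forall>i. 1 \<le> i \<and> i < r \<longrightarrow> (\<tau> i, \<tau> (i + 1)) \<in> \<Omega>) \<longrightarrow>
        (\<exists>j. 1 < j \<and> j < r \<and> \<tau> j \<in> J))"

text \<open>
  Functions on \<open>S\<close> are represented as elements of \<open>extensional S\<close>, so that the vector space
  operations are pointwise on \<open>S\<close> and equality is equality on \<open>S\<close>. For \<open>S = {}\<close> the only such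
  function is the zero function.
\<close>

definition hilbert_function_space ::
  "'a set \<Rightarrow> ('a \<Rightarrow> real) set \<Rightarrow> (('a \<Rightarrow> real) \<Rightarrow> ('a \<Rightarrow> real) \<Rightarrow> real) \<Rightarrow> bool" where
  "hilbert_function_space S H ip \<longleftrightarrow>
     H \<subseteq> extensional S \<and>
     (\<lambda>x\<in>S. 0) \<in> H \<and>
     (\<forall>f\<in>H. \<forall>g\<in>H. (\<lambda>x\<in>S. f x + g x) \<in> H) \<and>
     (\<forall>c. \<forall>f\<in>H. (\<lambda>x\<in>S. c * f x) \<in> H) \<and>
     (\<forall>f\<in>H. \<forall>g\<in>H. ip f g = ip g f) \<and>
     (\<forall>f\<in>H. \<forall>g\<in>H. \<forall>h\<in>H. ip (\<lambda>x\<in>S. f x + g x) h = ip f h + ip g h) \<and>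
     (\<forall>c. \<forall>f\<in>H. \<forall>g\<in>H. ip (\<lambda>x\<in>S. c * f x) g = c * ip f g) \<and>
     (\<forall>f\<in>H. 0 \<le> ip f f) \<and>
     (\<forall>f\<in>H. ip f f = 0 \<longrightarrow> f = (\<lambda>x\<in>S. 0)) \<and>
     (let d = (\<lambda>f g. sqrt (ip (\<lambda>x\<in>S. f x - g x) (\<lambda>x\<in>S. f x - g x))) in
       \<forall>u :: nat \<Rightarrow> 'a \<Rightarrow> real.
         (\<forall>n. u n \<in> H) \<and> (\<forall>e>0. \<exists>N. \<forall>m\<ge>N. \<forall>n\<ge>N. d (u m) (u n) < e) \<longrightarrow>
         (\<exists>f\<in>H. (\<lambda>n. d (u n) f) \<longlonglongrightarrow> 0))"

definition is_rkhs ::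
  "'a set \<Rightarrow> ('a \<times> 'a \<Rightarrow> real) \<Rightarrow> ('a \<Rightarrow> real) set \<Rightarrow> (('a \<Rightarrow> real) \<Rightarrow> ('a \<Rightarrow> real) \<Rightarrow> real) \<Rightarrow> bool"
where
  "is_rkhs S K H ip \<longleftrightarrow>
     hilbert_function_space S H ip \<and>
     (\<forall>t\<in>S. (\<lambda>x\<in>S. K (x, t)) \<in> H \<and> (\<forall>f\<in>H. ip f (\<lambda>x\<in>S. K (x, t)) = f t))"

text \<open>
  By the Moore--Aronszajn theorem, for a covariance \<open>K\<close> on \<open>S\<close> there is exactly one Hilbert space
  of functions on \<open>S\<close> with reproducing kernel \<open>K\<close>. Hence the choice below fixes the carrier, and the
  inner product of any two of its elements.
\<close>

definition rkhs ::
  "'a set \<Rightarrow> ('a \<times> 'a \<Rightarrow> real) \<Rightarrow> ('a \<Rightarrow> real) set \<times> (('a \<Rightarrow> real) \<Rightarrow> ('a \<Rightarrow> real) \<Rightarrow> real)" where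
  "rkhs S K = (SOME (H, ip). is_rkhs S K H ip)"

definition rkhs_inner ::
  "'a set \<Rightarrow> ('a \<times> 'a \<Rightarrow> real) \<Rightarrow> ('a \<Rightarrow> real) \<Rightarrow> ('a \<Rightarrow> real) \<Rightarrow> real" where
  "rkhs_inner S K = snd (rkhs S K)"

text \<open>
  For a covariance \<open>K\<close> on \<open>I\<close> and \<open>J \<subseteq> I\<close>, the restrictions to \<open>J\<close> of \<open>K(s, _)\<close> and \<open>K(_, t)\<close>
  always lie in the reproducing kernel Hilbert space of \<open>K\<close> restricted to \<open>J \<times> J\<close>, so the inner
  product below is meaningful for all \<open>s, t \<in> I\<close>.
\<close>

definition graphical_covariances :: "'a set \<Rightarrow> ('a \<times> 'a) set \<Rightarrow> ('a \<times> 'a \<Rightarrow> real) set" where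
  "graphical_covariances I \<Omega> =
     {K. covariance_on I K \<and>
         (\<forall>J s t. J \<subseteq> I \<and> s \<in> I \<and> t \<in> I \<and> separates I \<Omega> J s t \<longrightarrow>
            K (s, t) = rkhs_inner J (restrict K (J \<times> J)) (\<lambda>u\<in>J. K (s, u)) (\<lambda>u\<in>J. K (u, t)))}"

definition canonical_completion ::
  "'a set \<Rightarrow> ('a \<times> 'a) set \<Rightarrow> ('a \<times> 'a \<Rightarrow> real) \<Rightarrow> ('a \<times> 'a \<Rightarrow> real) \<Rightarrow> bool" where
  "canonical_completion I \<Omega> K\<^sub>\<Omega> K \<longleftrightarrow> completion I \<Omega> K\<^sub>\<Omega> K \<and> K \<in> graphical_covariances I \<Omega>"

end

theory Submission
  imports Defs
begin

text \<open>
  Both directions rest on monotonicity in the domain. A chain with steps in a smaller domain is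
  also a chain in a larger one, so every separation in the larger domain is a separation in the
  smaller one (\<open>separates_antimono\<close>). The reproducing identity
  \<open>K(s, t) = \<langle>K(s, _), K(_, t)\<rangle>\<close> that defines the class of graphical covariances depends on
  the domain only through the triples \<open>J, s, t\<close> for which it is demanded; a larger domain
  demands it less often, and the class grows with the domain (\<open>graphical_covariances_mono\<close>).

  Hence a covariance that is the canonical completion from some domain inside \<open>\<Omega>\<close> is graphical for
  \<open>\<Omega>\<close>, and it trivially completes its own restriction to \<open>\<Omega>\<close>. Conversely \<open>\<Omega>\<close> itself is the nearly
  serrated domain sought: a serrated domain is its own inner and outer approximation, at Hausdorff
  distance zero, and restricting a covariance to it gives a partial covariance.
\<close>

lemma separates_antimono:
  fixes I :: "'a set"
  assumes "\<Omega>' \<subseteq> \<Omega>" and "separates I \<Omega> J s t"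
  shows "separates I \<Omega>' J s t"
  unfolding separates_def
proof (intro allI impI, elim conjE)
  fix r :: nat and \<tau> :: "nat \<Rightarrow> 'a"
  assume r: "1 \<le> r" and \<tau>: "\<forall>i\<in>{1..r}. \<tau> i \<in> I" "\<tau> 1 = s" "\<tau> r = t"
    and step: "\<forall>i. 1 \<le> i \<and> i < r \<longrightarrow> (\<tau> i, \<tau> (i + 1)) \<in> \<Omega>'"
  have "\<forall>i. 1 \<le> i \<and> i < r \<longrightarrow> (\<tau> i, \<tau> (i + 1)) \<in> \<Omega>"
    using step assms(1) by blast
  then show "\<exists>j. 1 < j \<and> j < r \<and> \<tau> j \<in> J"
    using assms(2)[unfolded separates_def, rule_format, of r \<tau>] r \<tau> by simp
qed

lemma graphical_covariances_mono:
  assumes "\<Omega>' \<subseteq> \<Omega>"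
  shows "graphical_covariances I \<Omega>' \<subseteq> graphical_covariances I \<Omega>"
  using separates_antimono[OF assms] unfolding graphical_covariances_def by blast

lemma serrated_imp_symmetric_domain:
  assumes "serrated I \<Omega>"
  shows "symmetric_domain I \<Omega>"
  using assms unfolding serrated_def symmetric_domain_def by blast

lemma hausdorff_dist_self: "hausdorff_dist A A = 0"
proof -
  have "(INF b\<in>A. ennreal (dist a b)) = 0" if "a \<in> A" for a
    using INF_lower[OF that, of "\<lambda>b. ennreal (dist a b)"] by simp
  moreover have "(INF a\<in>A. ennreal (dist a b)) = 0" if "b \<in> A" for b
    using INF_lower[OF that, of "\<lambda>a. ennreal (dist a b)"] by simp
  ultimately show ?thesis
    by (cases "A = {}") (simp_all add: hausdorff_dist_def bot_ennreal cong: SUP_cong)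
qed

lemma serrated_imp_nearly_serrated:
  assumes "serrated I \<Omega>"
  shows "nearly_serrated I \<Omega>"
  unfolding nearly_serrated_def
proof (intro conjI allI impI)
  show "symmetric_domain I \<Omega>"
    by (rule serrated_imp_symmetric_domain[OF assms])
  fix \<epsilon> :: real
  assume "\<epsilon> > 0"
  then show "\<exists>L U. serrated I L \<and> serrated I U \<and> L \<subseteq> \<Omega> \<and> \<Omega> \<subseteq> U \<and>
      hausdorff_dist \<Omega> L < ennreal \<epsilon> \<and> hausdorff_dist \<Omega> U < ennreal \<epsilon>"
    using assms by (intro exI[of _ \<Omega>]) (simp add: hausdorff_dist_self)
qed

lemma covariance_on_subset:
  assumes "covariance_on I K" and "J \<subseteq> I"
  shows "covariance_on J K"
proof -
  have "\<forall>i\<in>{1..n}. t i \<in> I" if "\<forall>i\<in>{1..n}. t i \<in> J" for n :: nat and t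
    using that assms(2) by blast
  then show ?thesis
    using assms by (simp add: covariance_on_def subset_iff)
qed

lemma covariance_on_cong:
  assumes "\<And>s t. s \<in> S \<Longrightarrow> t \<in> S \<Longrightarrow> K (s, t) = K' (s, t)"
  shows "covariance_on S K \<longleftrightarrow> covariance_on S K'"
proof -
  have "(\<Sum>i=1..n. \<Sum>j=1..n. \<alpha> i * \<alpha> j * K (t i, t j)) =
      (\<Sum>i=1..n. \<Sum>j=1..n. \<alpha> i * \<alpha> j * K' (t i, t j))"
    if "\<forall>i\<in>{1..n}. t i \<in> S" for n t and \<alpha> :: "nat \<Rightarrow> real"
    using that assms by (intro sum.cong) auto
  then show ?thesis
    unfolding covariance_on_def using assms by (simp cong: imp_cong)
qed

lemma partial_covariance_restrict:
  assumes "symmetric_domain I \<Omega>" and "covariance_on I K"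
  shows "partial_covariance I \<Omega> (restrict K \<Omega>)"
  unfolding partial_covariance_def
proof (intro conjI allI impI)
  fix J
  assume J: "J \<subseteq> I \<and> J \<times> J \<subseteq> \<Omega>"
  then have "covariance_on J K"
    using covariance_on_subset assms(2) by blast
  moreover have "K (s, t) = restrict (restrict K \<Omega>) (J \<times> J) (s, t)" if "s \<in> J" "t \<in> J" for s t
    using J that by auto
  ultimately show "covariance_on J (restrict (restrict K \<Omega>) (J \<times> J))"
    using covariance_on_cong by blast
qed (fact assms(1))

theorem theorem8p4:
  fixes I :: "real set" and \<Omega> :: "(real \<times> real) set" and K :: "real \<times> real \<Rightarrow> real"
  assumes "is_interval I"
    and "serrated I \<Omega>"
    and "covariance_on I K"
  shows "canonical_completion I \<Omega> (restrict K \<Omega>) K \<longleftrightarrow>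
    (\<exists>\<Omega>' K'. nearly_serrated I \<Omega>' \<and> \<Omega>' \<subseteq> \<Omega> \<and> partial_covariance I \<Omega>' K' \<and>
       canonical_completion I \<Omega>' K' K)"
proof
  assume "canonical_completion I \<Omega> (restrict K \<Omega>) K"
  moreover have "partial_covariance I \<Omega> (restrict K \<Omega>)"
    using partial_covariance_restrict serrated_imp_symmetric_domain assms by blast
  ultimately show "\<exists>\<Omega>' K'. nearly_serrated I \<Omega>' \<and> \<Omega>' \<subseteq> \<Omega> \<and> partial_covariance I \<Omega>' K' \<and>
      canonical_completion I \<Omega>' K' K"
    using serrated_imp_nearly_serrated[OF assms(2)] by blast
next
  assume "\<exists>\<Omega>' K'. nearly_serrated I \<Omega>' \<and> \<Omega>' \<subseteq> \<Omega> \<and> partial_covariance I \<Omega>' K' \<and>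
      canonical_completion I \<Omega>' K' K"
  then have "K \<in> graphical_covariances I \<Omega>"
    using graphical_covariances_mono unfolding canonical_completion_def by blast
  then show "canonical_completion I \<Omega> (restrict K \<Omega>) K"
    using assms(3) by (simp add: canonical_completion_def completion_def)
qed

end
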